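(* For every $\alpha\in\Lambda$, $$\Psi(x^\alpha)=\alpha!\sum_{T\in\mathcal{T},\ M(T)=x^\alpha}\frac1{s_T}\,T.$$ In particular, if $\deg(x^\alpha)\neq0$, then $\Psi(x^\alpha)=0$.
   Context: $\mathbb{K}$ is a field of characteristic $0$. $\Lambda$ is the set of nonzero finitely supported sequences $\alpha=(\alpha_i)_{i\in\mathbb{N}}$ of nonnegative integers; $x^\alpha=\prod x_i^{\alpha_i}$ in commuting indeterminates $x_i$, $\alpha!=\prod\alpha_i!$, $\deg(x^\alpha)=1+\sum_i(i-1)\alpha_i$. $\mathcal{T}$ is the set of (unlabelled) rooted trees; $H_{\mathrm{CK}}$ is the polynomial algebra on $\mathcal{T}$ (basis: rooted forests). For a forest $F$, $s_F$ is its number of automorphisms; $H_{\mathrm{CK}}$ is paired with itself by $\langle F,G\rangle=s_F\delta_{F,G}$. For a rooted tree $T$, $M(T)=\prod_{v\in V(T)}x_{f_T(v)}$ and $N(T)=\prod_{v}X_{f_T(v)}\in\mathbb{K}[X_i]_+$, where $f_T(v)$ is the number of children of $v$. Pair $\mathbb{K}[x_i]_+$ with $\mathbb{K}[X_i]_+$ by $\langle x^\alpha,X^\beta\rangle=\alpha!\delta_{\alpha,\beta}$, extended to the symmetric algebras $S(\mathbb{K}[x_i]_+)$, $S(\mathbb{K}[X_i]_+)$ (product $|$) by $\langle P_1|\cdots|P_k,Q_1|\cdots|Q_l\rangle=\delta_{k,l}\sum_{\sigma}\prod\langle P_i,Q_{\sigma(i)}\rangle$. Let $\Theta$ be the linear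 map sending a forest $T_1\cdots T_k$ to $N(T_1)|\cdots|N(T_k)$ (this is the Guin–Oudom extension of the pre-Lie morphism induced by the operad morphism $\mathbf{PL}\to\mathbf{NMI}$, $\blacktriangleleft\mapsto X_1X_0$). $\Psi:S(\mathbb{K}[x_i]_+)\to H_{\mathrm{CK}}$ is the transpose of $\Theta$: $\langle\Psi(a),F\rangle=\langle a,\Theta(F)\rangle$ for all $a$ and all forests $F$. *)

theory Defs
  imports
    Complex_Main
    "HOL-Library.Multiset"
    "HOL-Library.Poly_Mapping"
    "HOL-Library.FuncSet"
    "HOL-Combinatorics.Permutations"
begin

section \<open>Free modules\<close>

text \<open>
  \<open>'b \<Rightarrow>\<^sub>0 'k\<close> is the vector space with basis \<open>'b\<close>; \<open>Poly_Mapping.map ((*) c)\<close> is scalar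
  multiplication by \<open>c\<close>. If \<open>'b\<close> is a commutative monoid, the product of \<open>'b \<Rightarrow>\<^sub>0 'k\<close> is that of
  the monoid algebra. In particular \<open>'b multiset \<Rightarrow>\<^sub>0 'k\<close> is the polynomial algebra on
  \<open>'b\<close>, i.e. the symmetric algebra of \<open>'b \<Rightarrow>\<^sub>0 'k\<close>.
\<close>

definition lin_ext :: "('b \<Rightarrow> 'c \<Rightarrow>\<^sub>0 'k) \<Rightarrow> ('b \<Rightarrow>\<^sub>0 'k) \<Rightarrow> ('c \<Rightarrow>\<^sub>0 'k::comm_ring_1)" where
  "lin_ext f p = (\<Sum>b\<in>Poly_Mapping.keys p. Poly_Mapping.map ((*) (Poly_Mapping.lookup p b)) (f b))"

definition bilin_ext :: "('b \<Rightarrow> 'c \<Rightarrow> 'k) \<Rightarrow> ('b \<Rightarrow>\<^sub>0 'k) \<Rightarrow> ('c \<Rightarrow>\<^sub>0 'k) \<Rightarrow> 'k::comm_ring_1" where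
  "bilin_ext B p q = (\<Sum>b\<in>Poly_Mapping.keys p. \<Sum>c\<in>Poly_Mapping.keys q.
      Poly_Mapping.lookup p b * Poly_Mapping.lookup q c * B b c)"


section \<open>Polynomials in infinitely many indeterminates\<close>

type_synonym expo = "nat \<Rightarrow>\<^sub>0 nat"

type_synonym 'k pol = "expo \<Rightarrow>\<^sub>0 'k"

text \<open>
  Both copies \<open>\<bbbK>[x\<^sub>i]\<close> and \<open>\<bbbK>[X\<^sub>i]\<close> of the polynomial algebra are rendered by \<^typ>\<open>'k pol\<close>.
\<close>

definition \<Lambda> :: "expo set" where
  "\<Lambda> = {\<alpha>. \<alpha> \<noteq> 0}"

definition xvar :: "nat \<Rightarrow> 'k::comm_ring_1 pol" where
  "xvar i = Poly_Mapping.single (Poly_Mapping.single i 1) 1"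

definition xpow :: "expo \<Rightarrow> 'k::comm_ring_1 pol" where
  "xpow \<alpha> = (\<Prod>i\<in>Poly_Mapping.keys \<alpha>. xvar i ^ Poly_Mapping.lookup \<alpha> i)"

definition expo_fact :: "expo \<Rightarrow> nat" where
  "expo_fact \<alpha> = (\<Prod>i\<in>Poly_Mapping.keys \<alpha>. fact (Poly_Mapping.lookup \<alpha> i))"

definition expo_deg :: "expo \<Rightarrow> int" where
  "expo_deg \<alpha> = 1 + (\<Sum>i\<in>Poly_Mapping.keys \<alpha>. (int i - 1) * int (Poly_Mapping.lookup \<alpha> i))"

definition pair_pol :: "'k::comm_ring_1 pol \<Rightarrow> 'k pol \<Rightarrow> 'k" where
  "pair_pol = bilin_ext (\<lambda>\<alpha> \<beta>. if \<alpha> = \<beta> then of_nat (expo_fact \<alpha>) else 0)"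


section \<open>The symmetric algebra\<close>

text \<open>
  The symmetric algebra of \<^typ>\<open>'k pol\<close> has as basis the monomials \<open>x\<^bsup>\<alpha>1\<^esup>|\<dots>|x\<^bsup>\<alpha>k\<^esup>\<close>, represented
  by the multisets of the \<open>\<alpha>i\<close>; its product \<open>|\<close> is \<open>*\<close>. As the polynomials without constant term
  have the basis \<open>x\<^bsup>\<alpha>\<^esup>\<close>, \<open>\<alpha> \<in> \<Lambda>\<close>, their symmetric algebra is the following subalgebra.
\<close>

type_synonym 'k sym = "expo multiset \<Rightarrow>\<^sub>0 'k"

definition Sym_plus :: "'k::comm_ring_1 sym set" where
  "Sym_plus = {a. \<forall>m\<in>Poly_Mapping.keys a. set_mset m \<subseteq> \<Lambda>}"

definition sym_incl :: "'k::comm_ring_1 pol \<Rightarrow> 'k sym" where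
  "sym_incl = lin_ext (\<lambda>\<alpha>. Poly_Mapping.single {#\<alpha>#} 1)"

text \<open>
  The pairing is given on the basis of monomials; \<open>pair_sym_prod\<close> below is the formula
  for general products \<open>P\<^sub>1|\<dots>|P\<^sub>k\<close> and \<open>Q\<^sub>1|\<dots>|Q\<^sub>l\<close>. The order in which the elements
  of a multiset are listed is irrelevant because of the sum over all permutations.
\<close>

definition pair_list :: "'k::comm_ring_1 pol list \<Rightarrow> 'k pol list \<Rightarrow> 'k" where
  "pair_list Ps Qs =
     (if length Ps = length Qs
      then \<Sum>\<sigma> | \<sigma> permutes {..<length Ps}. \<Prod>i<length Ps. pair_pol (Ps ! i) (Qs ! \<sigma> i)
      else 0)"

definition pair_sym :: "'k::comm_ring_1 sym \<Rightarrow> 'k sym \<Rightarrow> 'k" where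
  "pair_sym = bilin_ext (\<lambda>m n. pair_list (map xpow (sorted_list_of_multiset m))
                                         (map xpow (sorted_list_of_multiset n)))"


section \<open>Rooted trees and forests\<close>

text \<open>Unlabelled and non-planar rooted trees; a forest is a multiset of trees.\<close>

datatype rtree = Node (children: "rtree multiset")

type_synonym forest = "rtree multiset"

text \<open>
  Vertices are identified by the path leading to them from a root: each step \<open>(T, j)\<close>
  of the path enters the \<open>j\<close>-th of the copies of \<open>T\<close> among the trees of the current forest.
\<close>

primrec is_path :: "forest \<Rightarrow> (rtree \<times> nat) list \<Rightarrow> bool" where
  "is_path F [] = True"
| "is_path F (p # ps) = (snd p < count F (fst p) \<and> is_path (children (fst p)) ps)"

definition vertices :: "forest \<Rightarrow> (rtree \<times> nat) list set" where
  "vertices F = {v. v \<noteq> [] \<and> is_path F v}"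

text \<open>The pairs (parent, child).\<close>

definition edges :: "forest \<Rightarrow> ((rtree \<times> nat) list \<times> (rtree \<times> nat) list) set" where
  "edges F = {(v, w). v \<in> vertices F \<and> w \<in> vertices F \<and> v = butlast w}"

definition fertility :: "forest \<Rightarrow> (rtree \<times> nat) list \<Rightarrow> nat" where
  "fertility F v = card {w. (v, w) \<in> edges F}"

text \<open>
  The roots are the vertices without parent, so that automorphisms preserve them. The
  predicate \<open>permutes\<close> makes \<open>\<phi>\<close> the identity outside \<open>vertices F\<close>.
\<close>

definition forest_aut :: "forest \<Rightarrow> ((rtree \<times> nat) list \<Rightarrow> (rtree \<times> nat) list) set" where
  "forest_aut F = {\<phi>. \<phi> permutes vertices F \<and>
     (\<forall>v\<in>vertices F. \<forall>w\<in>vertices F. (\<phi> v, \<phi> w) \<in> edges F \<longleftrightarrow> (v, w) \<in> edges F)}"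

definition sym_factor :: "forest \<Rightarrow> nat" where
  "sym_factor F = card (forest_aut F)"

text \<open>The monomial \<open>M(T)\<close> in the \<open>x\<^sub>i\<close>, which is also the monomial \<open>N(T)\<close> in the \<open>X\<^sub>i\<close>.\<close>

definition tree_monom :: "rtree \<Rightarrow> 'k::comm_ring_1 pol" where
  "tree_monom T = (\<Prod>v\<in>vertices {#T#}. xvar (fertility {#T#} v))"


section \<open>The Connes--Kreimer algebra and the map \<open>\<Psi>\<close>\<close>

type_synonym 'k HCK = "forest \<Rightarrow>\<^sub>0 'k"

definition pair_CK :: "'k::comm_ring_1 HCK \<Rightarrow> 'k HCK \<Rightarrow> 'k" where
  "pair_CK = bilin_ext (\<lambda>F G. if F = G then of_nat (sym_factor F) else 0)"

definition \<Theta> :: "'k::comm_ring_1 HCK \<Rightarrow> 'k sym" where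
  "\<Theta> = lin_ext (\<lambda>F. \<Prod>T\<in>#F. sym_incl (tree_monom T))"

text \<open>See \<open>Psi_ex1\<close> and \<open>Psi_transpose\<close> below for existence and uniqueness.\<close>

definition \<Psi> :: "'k::field_char_0 sym \<Rightarrow> 'k HCK" where
  "\<Psi> = (\<lambda>a\<in>Sym_plus. THE h. \<forall>F. pair_CK h (Poly_Mapping.single F 1) =
                                 pair_sym a (\<Theta> (Poly_Mapping.single F 1)))"

section \<open>Well-definedness\<close>

text \<open>
  Main results: \<open>pair_sym_prod\<close>, \<open>finite_trees_monom\<close> (finitely many trees have a given
  monomial), \<open>Psi_ex1\<close> and \<open>Psi_transpose\<close>.
\<close>

lemma lookup_map_scale [simp]:
  "Poly_Mapping.lookup (Poly_Mapping.map ((*) (c::'k::comm_ring_1)) p) x = c * Poly_Mapping.lookup p x"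
  by (simp add: Poly_Mapping.map.rep_eq "when_def")

lemma bilin_ext_superset:
  assumes "finite A" "finite B" "Poly_Mapping.keys p \<subseteq> A" "Poly_Mapping.keys q \<subseteq> B"
  shows "bilin_ext f p q = (\<Sum>b\<in>A. \<Sum>c\<in>B. Poly_Mapping.lookup p b * Poly_Mapping.lookup q c * f b c)"
proof -
  have "bilin_ext f p q = (\<Sum>b\<in>Poly_Mapping.keys p. \<Sum>c\<in>B. Poly_Mapping.lookup p b * Poly_Mapping.lookup q c * f b c)"
    unfolding bilin_ext_def
    by (intro sum.cong refl sum.mono_neutral_left) (use assms in \<open>auto simp: in_keys_iff\<close>)
  also have "\<dots> = (\<Sum>b\<in>A. \<Sum>c\<in>B. Poly_Mapping.lookup p b * Poly_Mapping.lookup q c * f b c)"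
    by (intro sum.mono_neutral_left) (use assms in \<open>auto simp: in_keys_iff\<close>)
  finally show ?thesis .
qed

lemma bilin_ext_single [simp]:
  "bilin_ext f (Poly_Mapping.single b c) (Poly_Mapping.single b' c') = c * c' * f b b'"
  by (subst bilin_ext_superset[of "{b}" "{b'}"]) auto

lemma bilin_ext_sum_left:
  assumes "finite I"
  shows "bilin_ext f (\<Sum>i\<in>I. p i) q = (\<Sum>i\<in>I. bilin_ext f (p i) q)"
proof -
  let ?A = "(\<Union>i\<in>I. Poly_Mapping.keys (p i))"
  have fin: "finite ?A" using assms by auto
  have sub: "Poly_Mapping.keys (\<Sum>i\<in>I. p i) \<subseteq> ?A" by (rule keys_sum)
  have "bilin_ext f (\<Sum>i\<in>I. p i) q =
      (\<Sum>b\<in>?A. \<Sum>c\<in>Poly_Mapping.keys q. \<Sum>i\<in>I. Poly_Mapping.lookup (p i) b * Poly_Mapping.lookup q c * f b c)"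
    by (subst bilin_ext_superset[OF fin _ sub order_refl])
       (auto simp: lookup_sum sum_distrib_right)
  also have "\<dots> = (\<Sum>b\<in>?A. \<Sum>i\<in>I. \<Sum>c\<in>Poly_Mapping.keys q. Poly_Mapping.lookup (p i) b * Poly_Mapping.lookup q c * f b c)"
    by (intro sum.cong refl) (rule sum.swap)
  also have "\<dots> = (\<Sum>i\<in>I. \<Sum>b\<in>?A. \<Sum>c\<in>Poly_Mapping.keys q. Poly_Mapping.lookup (p i) b * Poly_Mapping.lookup q c * f b c)"
    by (rule sum.swap)
  also have "\<dots> = (\<Sum>i\<in>I. bilin_ext f (p i) q)"
    by (intro sum.cong refl, subst bilin_ext_superset[OF fin, of "Poly_Mapping.keys q"]) auto
  finally show ?thesis .
qed

lemma bilin_ext_swap: "bilin_ext f p q = bilin_ext (\<lambda>x y. f y x) q p"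
  unfolding bilin_ext_def by (subst sum.swap) (simp add: mult_ac)

lemma bilin_ext_sum_right:
  assumes "finite I"
  shows "bilin_ext f q (\<Sum>i\<in>I. p i) = (\<Sum>i\<in>I. bilin_ext f q (p i))"
  by (subst (1 2) bilin_ext_swap) (rule bilin_ext_sum_left[OF assms])

lemma prod_single:
  "finite I \<Longrightarrow> (\<Prod>i\<in>I. Poly_Mapping.single (a i) (c i)) =
     (Poly_Mapping.single (\<Sum>i\<in>I. a i) (\<Prod>i\<in>I. c i) :: 'a::comm_monoid_add \<Rightarrow>\<^sub>0 'k::comm_ring_1)"
  by (induction I rule: finite_induct) (auto simp: mult_single)

lemma pm_sum_singles:
  "(\<Sum>i\<in>Poly_Mapping.keys p. Poly_Mapping.single i (Poly_Mapping.lookup p i)) = p"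
  by (rule poly_mapping_eqI) (auto simp: lookup_sum lookup_single "when_def" in_keys_iff)

lemma xvar_power: "xvar i ^ n = (Poly_Mapping.single (Poly_Mapping.single i n) 1 :: 'k::comm_ring_1 pol)"
  by (induction n) (auto simp: xvar_def mult_single simp flip: single_add)

lemma xpow_eq_single: "xpow \<alpha> = (Poly_Mapping.single \<alpha> 1 :: 'k::comm_ring_1 pol)"
  by (simp add: xpow_def xvar_power prod_single pm_sum_singles)

lemma pair_pol_xpow:
  "pair_pol (xpow \<alpha>) (xpow \<beta>) = (if \<alpha> = \<beta> then of_nat (expo_fact \<alpha>) else 0 :: 'k::comm_ring_1)"
  by (simp add: pair_pol_def xpow_eq_single)

lemma sym_incl_alt:
  "sym_incl P = (\<Sum>\<alpha>\<in>Poly_Mapping.keys P. Poly_Mapping.single {#\<alpha>#} (Poly_Mapping.lookup P \<alpha>))"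
  by (simp add: sym_incl_def lin_ext_def)

lemma sym_incl_single [simp]: "sym_incl (Poly_Mapping.single \<alpha> c) = Poly_Mapping.single {#\<alpha>#} c"
  by (cases "c = 0") (simp_all add: sym_incl_alt)


lemma permutes_lessI:
  assumes "\<sigma> permutes {..<n::nat}" "i < n"
  shows "\<sigma> i < n" "inv \<sigma> i < n"
  using permutes_in_image[OF assms(1), of i] permutes_in_image[OF permutes_inv[OF assms(1)], of i]
    assms(2) by auto

lemma pair_list_mset_right:
  assumes "mset Qs = mset Qs'"
  shows "pair_list Ps Qs = pair_list Ps Qs'"
proof (cases "length Ps = length Qs")
  case False
  with mset_eq_length[OF assms] show ?thesis by (simp add: pair_list_def)
next
  case True
  obtain p where p: "p permutes {..<length Qs'}" "permute_list p Qs' = Qs"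
    using mset_eq_permutation[OF assms] by blast
  have len: "length Qs' = length Ps" using True mset_eq_length[OF assms] by simp
  have nth: "Qs ! j = Qs' ! p j" if "j < length Ps" for j
    using permute_list_nth[OF p(1), of j] p(2) that len by simp
  have "pair_list Ps Qs =
      (\<Sum>\<sigma> | \<sigma> permutes {..<length Ps}. \<Prod>i<length Ps. pair_pol (Ps ! i) (Qs' ! (p \<circ> \<sigma>) i))"
    unfolding pair_list_def using True
    by (auto intro!: sum.cong prod.cong simp: nth permutes_lessI)
  also have "\<dots> = (\<Sum>\<sigma> | \<sigma> permutes {..<length Ps}. \<Prod>i<length Ps. pair_pol (Ps ! i) (Qs' ! \<sigma> i))"
    by (rule setum_permutations_compose_left[symmetric, of p]) (use p len in simp)
  finally show ?thesis using len by (simp add: pair_list_def)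
qed

lemma pair_pol_commute: "pair_pol P Q = pair_pol Q P"
  unfolding pair_pol_def by (subst bilin_ext_swap) (rule arg_cong[of _ _ "\<lambda>f. bilin_ext f Q P"], auto intro!: ext)

lemma pair_list_commute: "pair_list Ps Qs = pair_list Qs Ps"
proof (cases "length Ps = length Qs")
  case True
  have "(\<Prod>i<length Qs. pair_pol (Ps ! i) (Qs ! \<sigma> i)) = (\<Prod>i<length Qs. pair_pol (Qs ! i) (Ps ! inv \<sigma> i))"
    if "\<sigma> permutes {..<length Qs}" for \<sigma>
    using prod.permute[OF that, of "\<lambda>i. pair_pol (Qs ! i) (Ps ! inv \<sigma> i)"]
    by (simp add: permutes_inverses[OF that] pair_pol_commute)
  then have "pair_list Ps Qs =
      (\<Sum>\<sigma> | \<sigma> permutes {..<length Qs}. \<Prod>i<length Qs. pair_pol (Qs ! i) (Ps ! inv \<sigma> i))"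
    using True by (auto simp: pair_list_def intro!: sum.cong)
  also have "\<dots> = (\<Sum>\<sigma> | \<sigma> permutes {..<length Qs}. \<Prod>i<length Qs. pair_pol (Qs ! i) (Ps ! \<sigma> i))"
    by (rule sum_permutations_inverse[symmetric])
  finally show ?thesis using True by (simp add: pair_list_def)
qed (simp add: pair_list_def)

lemma pair_sym_single:
  fixes c d :: "'k::comm_ring_1"
  shows "pair_sym (Poly_Mapping.single (mset as) c) (Poly_Mapping.single (mset bs) d) =
     c * d * pair_list (map xpow as) (map xpow bs)"
proof -
  have "pair_list (map xpow (sorted_list_of_multiset (mset as))) (map xpow (sorted_list_of_multiset (mset bs)))
      = (pair_list (map xpow as) (map xpow bs) :: 'k)" (is "pair_list ?a ?b = _")
  proof -
    have "pair_list ?a ?b = pair_list ?a (map xpow bs)"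
      by (rule pair_list_mset_right) simp
    also have "\<dots> = pair_list (map xpow bs) ?a" by (rule pair_list_commute)
    also have "\<dots> = pair_list (map xpow bs) (map xpow as)"
      by (rule pair_list_mset_right) simp
    also have "\<dots> = pair_list (map xpow as) (map xpow bs)" by (rule pair_list_commute)
    finally show ?thesis .
  qed
  then show ?thesis by (simp add: pair_sym_def)
qed

lemma sym_incl_prod:
  "(\<Prod>i<k. sym_incl (P i)) =
    (\<Sum>f\<in>(\<Pi>\<^sub>E i\<in>{..<k}. Poly_Mapping.keys (P i)).
       Poly_Mapping.single (mset (map f [0..<k])) (\<Prod>i<k. Poly_Mapping.lookup (P i) (f i)))"
proof -
  have *: "mset (map f [0..<k]) = (\<Sum>i<k. {#f i#})" for f :: "nat \<Rightarrow> expo"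
    by (induction k) auto
  show ?thesis
    unfolding sym_incl_alt by (subst prod_sum_PiE) (simp_all add: prod_single * del: mset_map)
qed

theorem pair_sym_prod:
  fixes k l :: nat and P Q :: "nat \<Rightarrow> 'k::comm_ring_1 pol"
  shows "pair_sym (\<Prod>i<k. sym_incl (P i)) (\<Prod>j<l. sym_incl (Q j)) =
     (if k = l then \<Sum>\<sigma> | \<sigma> permutes {..<k}. \<Prod>i<k. pair_pol (P i) (Q (\<sigma> i)) else 0)"
proof -
  define A where "A = (\<Pi>\<^sub>E i\<in>{..<k}. Poly_Mapping.keys (P i))"
  define B where "B = (\<Pi>\<^sub>E i\<in>{..<l}. Poly_Mapping.keys (Q i))"
  have fin: "finite A" "finite B" unfolding A_def B_def by (auto intro!: finite_PiE)
  have eq: "pair_sym (\<Prod>i<k. sym_incl (P i)) (\<Prod>j<l. sym_incl (Q j)) =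
    (\<Sum>f\<in>A. \<Sum>g\<in>B. (\<Prod>i<k. Poly_Mapping.lookup (P i) (f i)) * (\<Prod>i<l. Poly_Mapping.lookup (Q i) (g i)) *
        pair_list (map xpow (map f [0..<k])) (map xpow (map g [0..<l])))"
    unfolding sym_incl_prod A_def[symmetric] B_def[symmetric]
    by (subst pair_sym_def, subst bilin_ext_sum_left[OF fin(1)], subst bilin_ext_sum_right[OF fin(2)],
        unfold pair_sym_def[symmetric] pair_sym_single) simp
  show ?thesis
  proof (cases "k = l")
    case False
    then show ?thesis unfolding eq by (simp add: pair_list_def)
  next
    case True
    have inner: "(\<Prod>i<k. pair_pol (P i) (Q (\<sigma> i))) = (\<Sum>f\<in>A. \<Sum>g\<in>B.
        (\<Prod>i<k. Poly_Mapping.lookup (P i) (f i)) * (\<Prod>i<l. Poly_Mapping.lookup (Q i) (g i)) *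
        (\<Prod>i<k. pair_pol (xpow (f i)) (xpow (g (\<sigma> i)))))"
      if \<sigma>: "\<sigma> permutes {..<k}" for \<sigma>
    proof -
      let ?C = "\<Pi>\<^sub>E i\<in>{..<k}. Poly_Mapping.keys (Q (\<sigma> i))"
      have pp: "pair_pol (P i) (Q (\<sigma> i)) = (\<Sum>b\<in>Poly_Mapping.keys (P i). \<Sum>c\<in>Poly_Mapping.keys (Q (\<sigma> i)).
         Poly_Mapping.lookup (P i) b * Poly_Mapping.lookup (Q (\<sigma> i)) c * pair_pol (xpow b) (xpow c))" for i
        by (subst pair_pol_def) (simp only: bilin_ext_def pair_pol_xpow)
      have "(\<Prod>i<k. pair_pol (P i) (Q (\<sigma> i))) = (\<Sum>f\<in>A. \<Sum>h\<in>?C. \<Prod>i<k.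
         Poly_Mapping.lookup (P i) (f i) * Poly_Mapping.lookup (Q (\<sigma> i)) (h i) * pair_pol (xpow (f i)) (xpow (h i)))"
        unfolding pp A_def by (subst prod_sum_PiE; (simp; fail)?) (subst prod_sum_PiE; simp)
      also have "\<dots> = (\<Sum>f\<in>A. \<Sum>g\<in>B. \<Prod>i<k.
         Poly_Mapping.lookup (P i) (f i) * Poly_Mapping.lookup (Q (\<sigma> i)) (g (\<sigma> i)) * pair_pol (xpow (f i)) (xpow (g (\<sigma> i))))"
      proof (rule sum.cong[OF refl])
        fix f
        show "(\<Sum>h\<in>?C. \<Prod>i<k. Poly_Mapping.lookup (P i) (f i) * Poly_Mapping.lookup (Q (\<sigma> i)) (h i) *
                  pair_pol (xpow (f i)) (xpow (h i))) =
              (\<Sum>g\<in>B. \<Prod>i<k. Poly_Mapping.lookup (P i) (f i) * Poly_Mapping.lookup (Q (\<sigma> i)) (g (\<sigma> i)) *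
                  pair_pol (xpow (f i)) (xpow (g (\<sigma> i))))"
        proof (rule sum.reindex_bij_witness[of _ "\<lambda>g. g \<circ> \<sigma>" "\<lambda>h. h \<circ> inv \<sigma>"], goal_cases)
          case (1 h) then show ?case by (simp add: comp_assoc permutes_inv_o[OF \<sigma>])
        next
          case (2 h)
          have "h (inv \<sigma> i) \<in> Poly_Mapping.keys (Q i)" if "i < k" for i
          proof -
            have "inv \<sigma> i < k" using permutes_lessI(2)[OF \<sigma> that] .
            then have "h (inv \<sigma> i) \<in> Poly_Mapping.keys (Q (\<sigma> (inv \<sigma> i)))" using 2 by (auto dest: PiE_mem)
            then show ?thesis by (simp add: permutes_inverses[OF \<sigma>])
          qed
          moreover have "inv \<sigma> i = i" if "i \<notin> {..<k}" for i
            using permutes_not_in[OF permutes_inv[OF \<sigma>] that] .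
          ultimately show ?case using 2 True unfolding B_def by (auto simp: PiE_iff extensional_def)
        next
          case (3 g) then show ?case by (simp add: comp_assoc permutes_inv_o[OF \<sigma>])
        next
          case (4 g)
          moreover have "\<sigma> i < k" if "i < k" for i using permutes_lessI(1)[OF \<sigma> that] .
          moreover have "\<sigma> i = i" if "i \<notin> {..<k}" for i using permutes_not_in[OF \<sigma> that] .
          ultimately show ?case using True unfolding B_def by (auto simp: PiE_iff extensional_def)
        next
          case (5 h) then show ?case by (simp add: permutes_inverses[OF \<sigma>])
        qed
      qed
      also have "\<dots> = (\<Sum>f\<in>A. \<Sum>g\<in>B.
        (\<Prod>i<k. Poly_Mapping.lookup (P i) (f i)) * (\<Prod>i<l. Poly_Mapping.lookup (Q i) (g i)) *
        (\<Prod>i<k. pair_pol (xpow (f i)) (xpow (g (\<sigma> i)))))"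
        using prod.permute[OF \<sigma>, of "\<lambda>i. Poly_Mapping.lookup (Q i) (_ i)"] True
        by (simp add: prod.distrib o_def)
      finally show ?thesis .
    qed
    have pl: "pair_list (map xpow (map f [0..<k])) (map xpow (map g [0..<l])) =
        (\<Sum>\<sigma> | \<sigma> permutes {..<k}. \<Prod>i<k. pair_pol (xpow (f i)) (xpow (g (\<sigma> i))) :: 'k)" for f g
      using True by (auto simp: pair_list_def permutes_lessI intro!: sum.cong prod.cong)
    have "(\<Sum>\<sigma> | \<sigma> permutes {..<k}. \<Prod>i<k. pair_pol (P i) (Q (\<sigma> i))) =
      (\<Sum>f\<in>A. \<Sum>g\<in>B. \<Sum>\<sigma> | \<sigma> permutes {..<k}.
        (\<Prod>i<k. Poly_Mapping.lookup (P i) (f i)) * (\<Prod>i<l. Poly_Mapping.lookup (Q i) (g i)) *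
        (\<Prod>i<k. pair_pol (xpow (f i)) (xpow (g (\<sigma> i)))))"
      by (simp add: inner sum.swap[of _ _ "{\<sigma>. \<sigma> permutes {..<k}}"])
    also have "\<dots> = pair_sym (\<Prod>i<k. sym_incl (P i)) (\<Prod>j<l. sym_incl (Q j))"
      unfolding eq pl by (simp add: sum_distrib_left)
    finally show ?thesis using True by simp
  qed
qed

lemma vertices_eq:
  "vertices F = (\<Union>T\<in>set_mset F. \<Union>j\<in>{..<count F T}.
      insert [(T, j)] ((#) (T, j) ` vertices (children T)))"
proof (intro set_eqI iffI)
  fix v assume "v \<in> vertices F"
  then obtain T j w where v: "v = (T, j) # w" "j < count F T" "is_path (children T) w"
    unfolding vertices_def by (cases v) auto
  moreover from v(2) have "T \<in># F" by (metis not_in_iff not_less_zero)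
  ultimately show "v \<in> (\<Union>T\<in>set_mset F. \<Union>j\<in>{..<count F T}. insert [(T, j)] ((#) (T, j) ` vertices (children T)))"
    by (cases "w = []") (auto simp: vertices_def)
qed (auto simp: vertices_def)

lemma finite_vertices_children: "finite (vertices (children T))"
proof (induction T)
  case (Node F)
  then show ?case by (subst vertices_eq) auto
qed

lemma finite_vertices [simp]: "finite (vertices F)"
  by (subst vertices_eq) (auto simp: finite_vertices_children)

lemma sym_factor_pos: "sym_factor F > 0"
proof -
  have "finite (forest_aut F)"
    by (rule finite_subset[OF _ finite_permutations[OF finite_vertices[of F]]]) (auto simp: forest_aut_def)
  moreover have "id \<in> forest_aut F" by (simp add: forest_aut_def permutes_id)
  ultimately show ?thesis unfolding sym_factor_def by (auto simp: card_gt_0_iff)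
qed

lemma sym_factor_nonzero [simp]: "sym_factor F \<noteq> 0"
  using sym_factor_pos[of F] by simp

lemma size_le_card_vertices: "size F \<le> card (vertices F)"
proof -
  have "size F = card (SIGMA T:set_mset F. {..<count F T})"
    by (simp add: size_multiset_overloaded_eq)
  also have "\<dots> = card ((\<lambda>p. [p]) ` (SIGMA T:set_mset F. {..<count F T}))"
    by (rule card_image[symmetric]) (auto simp: inj_on_def)
  also have "\<dots> \<le> card (vertices F)"
    by (rule card_mono[OF finite_vertices]) (auto simp: vertices_def)
  finally show ?thesis .
qed

lemma card_vertices_child:
  assumes "T \<in># F"
  shows "card (vertices (children T)) < card (vertices F)"
proof -
  have "card (vertices (children T)) = card ((#) (T, 0) ` vertices (children T))"
    by (rule card_image[symmetric]) (auto simp: inj_on_def)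
  also have "\<dots> < card (vertices F)"
  proof (rule psubset_card_mono)
    have "[(T, 0)] \<in> vertices F" using assms by (auto simp: vertices_def)
    moreover have "[(T, 0)] \<notin> (#) (T, 0) ` vertices (children T)" by (auto simp: vertices_def)
    ultimately show "(#) (T, 0) ` vertices (children T) \<subset> vertices F"
      using assms by (auto simp: vertices_def)
  qed simp
  finally show ?thesis .
qed

lemma finite_trees_bounded: "finite {T. card (vertices (children T)) < n}"
proof (induction n)
  case (Suc n)
  let ?A = "{T. card (vertices (children T)) < n}"
  have "{T. card (vertices (children T)) < Suc n} \<subseteq> Node ` (\<Union>k\<le>n. multisets_of_size ?A k)"
  proof
    fix T assume T: "T \<in> {T. card (vertices (children T)) < Suc n}"
    then have "children T \<in> multisets_of_size ?A (size (children T))" "size (children T) \<le> n"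
      using card_vertices_child[of _ "children T"] size_le_card_vertices[of "children T"]
      by (fastforce simp: multisets_of_size_def)+
    then show "T \<in> Node ` (\<Union>k\<le>n. multisets_of_size ?A k)"
      by (intro image_eqI[of _ _ "children T"]) auto
  qed
  moreover have "finite (Node ` (\<Union>k\<le>n. multisets_of_size ?A k))" using Suc by auto
  ultimately show ?case by (rule finite_subset)
qed simp

definition tree_expo :: "rtree \<Rightarrow> expo" where
  "tree_expo T = (\<Sum>v\<in>vertices {#T#}. Poly_Mapping.single (fertility {#T#} v) 1)"

lemma tree_monom_eq: "tree_monom T = xpow (tree_expo T)"
  by (simp add: tree_monom_def xvar_def prod_single xpow_eq_single tree_expo_def)

lemma finite_trees_expo: "finite {T. tree_expo T = \<alpha>}"
proof -
  let ?n = "\<Sum>i\<in>Poly_Mapping.keys \<alpha>. Poly_Mapping.lookup \<alpha> i"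
  have "card (vertices (children T)) < ?n" if "tree_expo T = \<alpha>" for T
  proof -
    have "?n = (\<Sum>i\<in>Poly_Mapping.keys \<alpha>. \<Sum>v\<in>vertices {#T#}. 1 when fertility {#T#} v = i)"
      unfolding that[symmetric] by (simp add: tree_expo_def lookup_sum lookup_single)
    also have "\<dots> = (\<Sum>v\<in>vertices {#T#}. \<Sum>i\<in>Poly_Mapping.keys \<alpha>. 1 when fertility {#T#} v = i)"
      by (rule sum.swap)
    also have "\<dots> = (\<Sum>v\<in>vertices {#T#}. 1)"
    proof (rule sum.cong[OF refl])
      fix v assume v: "v \<in> vertices {#T#}"
      have "Poly_Mapping.lookup \<alpha> (fertility {#T#} v) = (\<Sum>w\<in>vertices {#T#}. 1 when fertility {#T#} w = fertility {#T#} v)"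
        unfolding that[symmetric] by (simp add: tree_expo_def lookup_sum lookup_single)
      also have "\<dots> \<noteq> 0" using v by (auto intro!: bexI[of _ v])
      finally have "fertility {#T#} v \<in> Poly_Mapping.keys \<alpha>" by (simp add: in_keys_iff)
      then show "(\<Sum>i\<in>Poly_Mapping.keys \<alpha>. 1 when fertility {#T#} v = i) = (1::nat)"
        by (simp add: "when_def")
    qed
    finally have "?n = card (vertices {#T#})" by simp
    then show ?thesis using card_vertices_child[of T "{#T#}"] by simp
  qed
  then show ?thesis by (intro finite_subset[OF _ finite_trees_bounded[of ?n]]) auto
qed

lemma xpow_inject: "(xpow \<alpha> :: 'k::comm_ring_1 pol) = xpow \<beta> \<longleftrightarrow> \<alpha> = \<beta>"
  by (metis lookup_single_eq lookup_single_not_eq xpow_eq_single zero_neq_one)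

theorem finite_trees_monom: "finite {T. (tree_monom T :: 'k::comm_ring_1 pol) = xpow \<alpha>}"
  by (simp add: tree_monom_eq xpow_inject finite_trees_expo)

lemma Theta_single:
  "\<Theta> (Poly_Mapping.single F 1) = (\<Prod>T\<in>#F. sym_incl (tree_monom T))"
  by (rule poly_mapping_eqI) (simp add: \<Theta>_def lin_ext_def)

lemma Theta_single_eq:
  "\<Theta> (Poly_Mapping.single F 1) = Poly_Mapping.single (image_mset tree_expo F) 1"
  unfolding Theta_single
  by (induction F) (auto simp: tree_monom_eq xpow_eq_single mult_single)

lemma pair_list_nonzero_imp:
  assumes "pair_list (map xpow as) (map xpow bs) \<noteq> (0::'k::comm_ring_1)"
  shows "mset as = mset bs"
proof -
  have len: "length as = length bs" using assms by (auto simp: pair_list_def split: if_splits)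
  then obtain \<sigma> where \<sigma>: "\<sigma> permutes {..<length as}"
      "(\<Prod>i<length as. pair_pol (map xpow as ! i) (map xpow bs ! \<sigma> i)) \<noteq> (0::'k)"
    using assms by (auto simp: pair_list_def dest: sum.not_neutral_contains_not_neutral)
  have "as ! i = bs ! \<sigma> i" if "i < length as" for i
  proof (rule ccontr)
    assume "as ! i \<noteq> bs ! \<sigma> i"
    then have "pair_pol (map xpow as ! i) (map xpow bs ! \<sigma> i) = (0::'k)"
      using that len permutes_lessI(1)[OF \<sigma>(1) that] by (simp add: pair_pol_xpow)
    then have "(\<Prod>i<length as. pair_pol (map xpow as ! i) (map xpow bs ! \<sigma> i)) = (0::'k)"
      using that by (intro prod_zero bexI[of _ i]) simp_all
    with \<sigma>(2) show False by contradiction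
  qed
  then have "permute_list \<sigma> bs = as"
    using len \<sigma>(1) by (intro nth_equalityI) (auto simp: permute_list_nth)
  then show ?thesis using mset_permute_list[of \<sigma> bs] \<sigma>(1) len by simp
qed

lemma finite_pair_Theta: "finite {F. pair_sym a (\<Theta> (Poly_Mapping.single F 1)) \<noteq> 0}"
proof -
  let ?A = "{T. tree_expo T \<in> (\<Union>m\<in>Poly_Mapping.keys a. set_mset m)}"
  have "finite (\<Union>\<alpha>\<in>(\<Union>m\<in>Poly_Mapping.keys a. set_mset m). {T. tree_expo T = \<alpha>})"
    by (auto simp: finite_trees_expo)
  then have finA: "finite ?A" by (rule rev_finite_subset) auto
  have "{F. pair_sym a (\<Theta> (Poly_Mapping.single F 1)) \<noteq> 0} \<subseteq> (\<Union>m\<in>Poly_Mapping.keys a. multisets_of_size ?A (size m))"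
  proof
    fix F assume "F \<in> {F. pair_sym a (\<Theta> (Poly_Mapping.single F 1)) \<noteq> 0}"
    then have "pair_sym a (Poly_Mapping.single (image_mset tree_expo F) 1) \<noteq> 0"
      by (simp add: Theta_single_eq)
    then obtain m where m: "m \<in> Poly_Mapping.keys a"
       "pair_list (map xpow (sorted_list_of_multiset m))
          (map xpow (sorted_list_of_multiset (image_mset tree_expo F))) \<noteq> (0::'a)"
      unfolding pair_sym_def bilin_ext_def
      by (fastforce elim!: sum.not_neutral_contains_not_neutral)
    then have eq: "m = image_mset tree_expo F" using pair_list_nonzero_imp[OF m(2)] by simp
    have "F \<in> multisets_of_size ?A (size m)"
      using m(1) unfolding multisets_of_size_def eq by (auto intro!: bexI[of _ "image_mset tree_expo F"])
    then show "F \<in> (\<Union>m\<in>Poly_Mapping.keys a. multisets_of_size ?A (size m))"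
      using m(1) by blast
  qed
  then show ?thesis by (rule finite_subset) (use finA in \<open>intro finite_UN_I finite_multisets_of_size finite_keys\<close>)
qed

lemma pair_CK_single:
  "pair_CK h (Poly_Mapping.single F 1) = Poly_Mapping.lookup h F * of_nat (sym_factor F)"
  unfolding pair_CK_def
  by (subst bilin_ext_superset[of "insert F (Poly_Mapping.keys h)" "{F}"])
     (auto simp: if_distrib cong: if_cong)

theorem Psi_ex1:
  fixes a :: "'k::field_char_0 sym"
  shows "\<exists>!h. \<forall>F. pair_CK h (Poly_Mapping.single F 1) = pair_sym a (\<Theta> (Poly_Mapping.single F 1))"
proof -
  let ?f = "\<lambda>F. pair_sym a (\<Theta> (Poly_Mapping.single F 1)) / of_nat (sym_factor F)"
  have nz: "(of_nat (sym_factor F) :: 'k) \<noteq> 0" for F using sym_factor_pos[of F] by simp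
  have "finite {F. ?f F \<noteq> 0}"
    by (rule finite_subset[OF _ finite_pair_Theta[of a]]) auto
  then have *: "Poly_Mapping.lookup (Abs_poly_mapping ?f) = ?f" by simp
  show ?thesis
  proof (rule ex1I[of _ "Abs_poly_mapping ?f"])
    show "\<forall>F. pair_CK (Abs_poly_mapping ?f) (Poly_Mapping.single F 1) = pair_sym a (\<Theta> (Poly_Mapping.single F 1))"
      by (simp add: pair_CK_single * nz)
  next
    fix h assume h: "\<forall>F. pair_CK h (Poly_Mapping.single F 1) = pair_sym a (\<Theta> (Poly_Mapping.single F 1))"
    show "h = Abs_poly_mapping ?f"
      by (rule poly_mapping_eqI) (simp add: * nz field_simps h[rule_format, symmetric] pair_CK_single)
  qed
qed

theorem Psi_transpose:
  assumes "a \<in> Sym_plus"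
  shows "pair_CK (\<Psi> a) (Poly_Mapping.single F 1) = pair_sym a (\<Theta> (Poly_Mapping.single F 1))"
  using theI'[OF Psi_ex1[of a]] assms by (simp add: \<Psi>_def)

end

theory Submission
  imports Defs
begin

text \<open>
  \<open>\<Theta>\<close> sends a forest of trees \<open>T\<^sub>1, \<dots>, T\<^sub>k\<close> to the single basis element with factors
  \<open>N(T\<^sub>1), \<dots>, N(T\<^sub>k)\<close>, so \<open>x\<^sup>\<alpha>\<close> pairs to zero with it unless \<open>k = 1\<close> and \<open>N(T\<^sub>1)\<close> has
  exponent \<open>\<alpha>\<close>, in which case the pairing is \<open>\<alpha>!\<close>. The vanishing statement holds because a tree
  has one vertex more than it has edges, so that \<open>M(T)\<close> has degree \<open>0\<close>.
\<close>

lemma pair_sym_singleton_left: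
  "pair_sym (Poly_Mapping.single {#\<alpha>#} 1) (Poly_Mapping.single m 1) =
     (if m = {#\<alpha>#} then of_nat (expo_fact \<alpha>) else 0 :: 'k::comm_ring_1)"
proof -
  obtain bs where m: "m = mset bs" using ex_mset by metis
  have *: "pair_sym (Poly_Mapping.single {#\<alpha>#} 1) (Poly_Mapping.single m 1) =
      (pair_list (map xpow [\<alpha>]) (map xpow bs) :: 'k)"
    using pair_sym_single[of "[\<alpha>]" 1 bs 1] m by simp
  show ?thesis
  proof (cases "m = {#\<alpha>#}")
    case True
    then have "bs = [\<alpha>]" using m by simp
    with True show ?thesis
      unfolding * by (simp add: pair_list_def pair_pol_xpow lessThan_Suc)
  next
    case False
    then show ?thesis
      using pair_list_nonzero_imp[of "[\<alpha>]" bs, where 'k = 'k] m unfolding * by auto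
  qed
qed

text \<open>The pairing on forests is diagonal with entries \<open>sym_factor F\<close>, so testing
  the transpose relation against \<open>F\<close> isolates a single coefficient. Characteristic 0
  allows the division.\<close>

lemma lookup_Psi_xpow:
  assumes "\<alpha> \<in> \<Lambda>"
  shows "Poly_Mapping.lookup (\<Psi> (sym_incl (xpow \<alpha>)) :: 'k::field_char_0 HCK) F =
    (if image_mset tree_expo F = {#\<alpha>#} then of_nat (expo_fact \<alpha>) / of_nat (sym_factor F) else 0)"
proof -
  have "(sym_incl (xpow \<alpha>) :: 'k sym) \<in> Sym_plus"
    using assms by (simp add: Sym_plus_def xpow_eq_single)
  from Psi_transpose[OF this, of F]
  have "Poly_Mapping.lookup (\<Psi> (sym_incl (xpow \<alpha>)) :: 'k HCK) F * of_nat (sym_factor F) =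
      (if image_mset tree_expo F = {#\<alpha>#} then of_nat (expo_fact \<alpha>) else 0)"
    by (simp add: pair_CK_single Theta_single_eq xpow_eq_single pair_sym_singleton_left)
  then show ?thesis by (simp add: field_simps split: if_splits)
qed

lemma Psi_xpow:
  assumes "\<alpha> \<in> \<Lambda>"
  shows "(\<Psi> (sym_incl (xpow \<alpha>)) :: 'k::field_char_0 HCK) =
    Poly_Mapping.map ((*) (of_nat (expo_fact \<alpha>)))
      (\<Sum>T\<in>{T. tree_expo T = \<alpha>}.
         Poly_Mapping.map ((*) (1 / of_nat (sym_factor {#T#}))) (Poly_Mapping.single {#T#} 1))"
proof (rule poly_mapping_eqI)
  fix F
  have sum: "(\<Sum>T | tree_expo T = \<alpha>. 1 / of_nat (sym_factor {#T#}) when {#T#} = F) =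
      (if image_mset tree_expo F = {#\<alpha>#} then 1 / of_nat (sym_factor F) else 0 :: 'k)"
  proof (cases "image_mset tree_expo F = {#\<alpha>#}")
    case True
    \<comment> \<open>A forest with a one-element image has exactly one tree, so only the summand of
      \<open>S\<close> survives.\<close>
    then obtain S where "F = {#S#}" "tree_expo S = \<alpha>"
      by (auto dest!: msed_map_invR)
    then show ?thesis
      by (simp add: "when_def" finite_trees_expo if_distrib cong: if_cong)
  next
    case False
    then have "{#T#} \<noteq> F" if "tree_expo T = \<alpha>" for T using that by auto
    with False show ?thesis by simp
  qed
  show "Poly_Mapping.lookup (\<Psi> (sym_incl (xpow \<alpha>)) :: 'k HCK) F =
    Poly_Mapping.lookup (Poly_Mapping.map ((*) (of_nat (expo_fact \<alpha>)))
      (\<Sum>T\<in>{T. tree_expo T = \<alpha>}.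
         Poly_Mapping.map ((*) (1 / of_nat (sym_factor {#T#}))) (Poly_Mapping.single {#T#} 1))) F"
    using sum by (simp add: lookup_Psi_xpow[OF assms] lookup_sum lookup_single)
qed

lemma is_path_append: "is_path F (v @ w) \<Longrightarrow> is_path F v"
  by (induction v arbitrary: F) auto

text \<open>\<open>T\<close> occurs once in \<open>{#T#}\<close>, so \<open>[(T, 0)]\<close> is the
  only path of length one. Its prefix is empty, hence not a vertex; a longer path has a nonempty
  prefix that is again a path.\<close>

lemma butlast_in_vertices_iff:
  assumes "w \<in> vertices {#T#}"
  shows "butlast w \<in> vertices {#T#} \<longleftrightarrow> w \<noteq> [(T, 0)]"
proof (cases w rule: rev_cases)
  case (snoc v p)
  then show ?thesis
    using assms is_path_append[of "{#T#}" v "[p]"]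
    by (cases p) (auto simp: vertices_def split: if_splits)
qed (use assms in \<open>simp add: vertices_def\<close>)

text \<open>The fibres of \<open>butlast\<close> over the vertices are their sets of children. They
  are disjoint and cover every vertex except the root, which \<open>Suc\<close> accounts
  for.\<close>

lemma sum_fertility_tree:
  "Suc (\<Sum>v\<in>vertices {#T#}. fertility {#T#} v) = card (vertices {#T#})"
proof -
  let ?V = "vertices {#T#}"
  have root: "[(T, 0)] \<in> ?V" by (simp add: vertices_def)
  have "(\<Sum>v\<in>?V. fertility {#T#} v) = (\<Sum>v\<in>?V. card {w \<in> ?V. butlast w = v})"
    by (intro sum.cong refl) (auto simp: fertility_def edges_def intro!: arg_cong[of _ _ card])
  also have "\<dots> = card (\<Union>v\<in>?V. {w \<in> ?V. butlast w = v})"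
    by (rule card_UN_disjoint[symmetric]) auto
  also have "(\<Union>v\<in>?V. {w \<in> ?V. butlast w = v}) = ?V - {[(T, 0)]}"
    using butlast_in_vertices_iff by auto
  also have "Suc (card \<dots>) = card ?V"
    using card.remove[OF finite_vertices root] by simp
  finally show ?thesis by simp
qed

lemma expo_deg_superset:
  assumes "finite A" "Poly_Mapping.keys \<alpha> \<subseteq> A"
  shows "expo_deg \<alpha> = 1 + (\<Sum>i\<in>A. (int i - 1) * int (Poly_Mapping.lookup \<alpha> i))"
  unfolding expo_deg_def
  by (intro arg_cong[of _ _ "(+) 1"] sum.mono_neutral_left) (use assms in \<open>auto simp: in_keys_iff\<close>)

text \<open>\<open>expo_deg\<close> minus 1 is additive, and a unit exponent at index i contributes
  i - 1. Repeated values of \<open>f\<close> are handled by exchanging the sums over indices and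
  over \<open>V\<close>.\<close>

lemma expo_deg_sum_single:
  assumes "finite V"
  shows "expo_deg (\<Sum>v\<in>V. Poly_Mapping.single (f v) 1) = 1 + (\<Sum>v\<in>V. int (f v) - 1)"
proof -
  have keys: "Poly_Mapping.keys (\<Sum>v\<in>V. Poly_Mapping.single (f v) (1::nat)) \<subseteq> f ` V"
    by (rule order_trans[OF keys_sum]) auto
  have "(\<Sum>i\<in>f ` V. (int i - 1) * (\<Sum>v\<in>V. int (1 when f v = i))) =
      (\<Sum>v\<in>V. \<Sum>i\<in>f ` V. (int i - 1) * int (1 when f v = i))"
    by (simp only: sum_distrib_left) (rule sum.swap)
  also have "\<dots> = (\<Sum>v\<in>V. int (f v) - 1)"
    using assms by (intro sum.cong refl) (simp add: "when_def" if_distrib cong: if_cong)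
  finally show ?thesis
    using assms by (simp add: expo_deg_superset[OF _ keys] lookup_sum lookup_single del: One_nat_def)
qed

text \<open>Fertility minus 1, summed over all vertices, is the number of edges minus the number of
  vertices. This is -1 and cancels the leading 1 of \<open>expo_deg\<close>.\<close>

lemma expo_deg_tree_expo: "expo_deg (tree_expo T) = 0"
  using arg_cong[OF sum_fertility_tree[of T], of int]
  by (simp add: tree_expo_def expo_deg_sum_single sum_subtractf del: One_nat_def)

theorem theorem3p16:
  fixes \<alpha> :: expo
  assumes "\<alpha> \<in> \<Lambda>"
  shows "(\<Psi> (sym_incl (xpow \<alpha>)) :: 'k::field_char_0 HCK) =
           Poly_Mapping.map ((*) (of_nat (expo_fact \<alpha>)))
             (\<Sum>T\<in>{T. (tree_monom T :: 'k pol) = xpow \<alpha>}.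
                Poly_Mapping.map ((*) (1 / of_nat (sym_factor {#T#})))
                  (Poly_Mapping.single {#T#} 1)) \<and>
         (expo_deg \<alpha> \<noteq> 0 \<longrightarrow> (\<Psi> (sym_incl (xpow \<alpha>)) :: 'k HCK) = 0)"
proof (intro conjI impI)
  show "(\<Psi> (sym_incl (xpow \<alpha>)) :: 'k HCK) =
           Poly_Mapping.map ((*) (of_nat (expo_fact \<alpha>)))
             (\<Sum>T\<in>{T. (tree_monom T :: 'k pol) = xpow \<alpha>}.
                Poly_Mapping.map ((*) (1 / of_nat (sym_factor {#T#})))
                  (Poly_Mapping.single {#T#} 1))"
    by (simp add: Psi_xpow[OF assms] tree_monom_eq xpow_inject)
next
  assume "expo_deg \<alpha> \<noteq> 0"
  then have none: "{T. tree_expo T = \<alpha>} = {}" using expo_deg_tree_expo by auto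
  show "(\<Psi> (sym_incl (xpow \<alpha>)) :: 'k HCK) = 0"
    by (rule poly_mapping_eqI) (simp add: Psi_xpow[OF assms] none)
qed

end
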